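(* For every integer $n \geq 3$, $$\gamma_{b,2}(P_5 \square C_n) = n + \begin{cases} 0 & \text{if } n \equiv 0 \pmod 2,\\ 1 & \text{if } n \equiv 1 \pmod 2.\end{cases}$$
   Context: For a graph $G$, a $2$-limited broadcast is a function $f: V(G) \to \{0,1,2\}$. A vertex $u$ hears the broadcast from $v$ if $f(v) > 0$ and $d(u,v) \leq f(v)$, where $d$ is the distance in $G$. The broadcast $f$ is dominating if every vertex of $G$ hears the broadcast from some vertex. The cost of $f$ is $\sum_{v \in V(G)} f(v)$. The $2$-limited broadcast domination number $\gamma_{b,2}(G)$ is the minimum cost of a $2$-limited dominating broadcast on $G$. $C_n$ denotes the cycle on $n$ vertices, $P_5$ the path on $5$ vertices, and $\square$ the Cartesian product of graphs. *)

theory Defs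
  imports Main
begin

text \<open>A (simple, undirected) graph is given by a finite vertex set V and an
  adjacency relation adj; we only use graphs whose adjacency relation only
  relates vertices of V.\<close>

fun walk :: "('a \<Rightarrow> 'a \<Rightarrow> bool) \<Rightarrow> nat \<Rightarrow> 'a \<Rightarrow> 'a \<Rightarrow> bool" where
  "walk adj 0 u v = (u = v)"
| "walk adj (Suc k) u v = (\<exists>w. adj u w \<and> walk adj k w v)"

text \<open>Graph distance (for connected graphs): length of a shortest walk.\<close>
definition gdist :: "('a \<Rightarrow> 'a \<Rightarrow> bool) \<Rightarrow> 'a \<Rightarrow> 'a \<Rightarrow> nat" where
  "gdist adj u v = (LEAST k. walk adj k u v)"

definition dom_broadcast2 :: "'a set \<Rightarrow> ('a \<Rightarrow> 'a \<Rightarrow> bool) \<Rightarrow> ('a \<Rightarrow> nat) \<Rightarrow> bool" where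
  "dom_broadcast2 V adj f \<longleftrightarrow>
     (\<forall>v\<in>V. f v \<le> 2) \<and> (\<forall>v. v \<notin> V \<longrightarrow> f v = 0) \<and>
     (\<forall>u\<in>V. \<exists>v\<in>V. f v > 0 \<and> gdist adj u v \<le> f v)"

definition bcost :: "'a set \<Rightarrow> ('a \<Rightarrow> nat) \<Rightarrow> nat" where
  "bcost V f = (\<Sum>v\<in>V. f v)"

definition gamma_b2 :: "'a set \<Rightarrow> ('a \<Rightarrow> 'a \<Rightarrow> bool) \<Rightarrow> nat" where
  "gamma_b2 V adj = Min {bcost V f | f. dom_broadcast2 V adj f}"

definition path_adj :: "nat \<Rightarrow> nat \<Rightarrow> nat \<Rightarrow> bool" where
  "path_adj m i j \<longleftrightarrow> i < m \<and> j < m \<and> (j = i + 1 \<or> i = j + 1)"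

definition cycle_adj :: "nat \<Rightarrow> nat \<Rightarrow> nat \<Rightarrow> bool" where
  "cycle_adj n i j \<longleftrightarrow> i < n \<and> j < n \<and> (j = (i + 1) mod n \<or> i = (j + 1) mod n)"

definition cart_adj :: "('a \<Rightarrow> 'a \<Rightarrow> bool) \<Rightarrow> 'a set \<Rightarrow> ('b \<Rightarrow> 'b \<Rightarrow> bool) \<Rightarrow> 'b set
    \<Rightarrow> 'a \<times> 'b \<Rightarrow> 'a \<times> 'b \<Rightarrow> bool" where
  "cart_adj adjG VG adjH VH x y \<longleftrightarrow>
     (fst x = fst y \<and> fst x \<in> VG \<and> adjH (snd x) (snd y)) \<or>
     (snd x = snd y \<and> snd x \<in> VH \<and> adjG (fst x) (fst y))"

end

theory Submission
  imports Defs
begin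

text \<open>
  Read the columns of the tube from left to right and call the cost of the columns read minus
  their number the excess. Whether the columns can still be completed to a dominating broadcast
  depends only on a state describing the last four columns. A finite table assigns to the relevant
  states a potential whose increments are bounded by a multiple of the excess of the column read,
  and a colour that changes whenever the bound is attained. Wrapped around the cycle, the states
  are periodic, so the total excess is nonnegative; if it vanishes, then every bound is attained,
  the colour alternates along the cycle, and \<open>n\<close> is even. For the upper bound, alternate
  columns with a \<open>2\<close> in the middle row and columns with a \<open>1\<close> in both outer rows,
  separated by empty columns, with a local repair when \<open>n mod 4 = 2\<close>.
\<close>

section \<open>Lookup tables\<close>

datatype 'a trie = Empty | Leaf 'a | Node "'a trie" "'a trie"

fun trie_insert :: "bool list \<Rightarrow> 'a \<Rightarrow> 'a trie \<Rightarrow> 'a trie" where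
  "trie_insert [] v t = Leaf v"
| "trie_insert (True # bs) v (Node l r) = Node l (trie_insert bs v r)"
| "trie_insert (False # bs) v (Node l r) = Node (trie_insert bs v l) r"
| "trie_insert (True # bs) v _ = Node Empty (trie_insert bs v Empty)"
| "trie_insert (False # bs) v _ = Node (trie_insert bs v Empty) Empty"

fun trie_lookup :: "'a trie \<Rightarrow> bool list \<Rightarrow> 'a option" where
  "trie_lookup (Leaf v) [] = Some v"
| "trie_lookup (Node l r) (True # bs) = trie_lookup r bs"
| "trie_lookup (Node l r) (False # bs) = trie_lookup l bs"
| "trie_lookup _ _ = None"

fun trie_of :: "(bool list \<times> 'a) list \<Rightarrow> 'a trie" where
  "trie_of [] = Empty"
| "trie_of (kv # kvs) = trie_insert (fst kv) (snd kv) (trie_of kvs)"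

lemma trie_lookup_insert:
  "trie_lookup (trie_insert bs v t) k = Some w \<Longrightarrow> k = bs \<and> w = v \<or> trie_lookup t k = Some w"
proof (induction bs arbitrary: t k)
  case Nil
  then show ?case by (cases k) auto
next
  case (Cons b bs)
  have "k \<noteq> []"
    using Cons.prems by (cases t; cases b) auto
  then obtain b' k' where k: "k = b' # k'"
    by (cases k) auto
  show ?case
    using Cons.prems Cons.IH[of _ k'] unfolding k
    by (cases t; cases b; cases b') (fastforce dest: Cons.IH)+
qed

text \<open>Soundness of lookups is what the check relies on: an insertion may overwrite or discard
  earlier entries, but a missed key yields \<open>None\<close>, which \<open>edge_ok\<close>
  rejects.\<close>

lemma trie_lookup_of: "trie_lookup (trie_of kvs) k = Some v \<Longrightarrow> (k, v) \<in> set kvs"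
proof (induction kvs)
  case (Cons kv kvs)
  then show ?case
    using trie_lookup_insert[of "fst kv" "snd kv" "trie_of kvs" k v] by (cases kv) auto
qed simp

section \<open>The transfer automaton of the columns\<close>

text \<open>\<open>k\<close> is the distance along the cycle from column \<open>x\<close>; truncated
  subtraction turns \<open>(r - r') + (r' - r)\<close> into the distance of the rows.\<close>

definition covers :: "nat \<Rightarrow> nat list \<Rightarrow> nat \<Rightarrow> bool" where
  "covers k x r \<longleftrightarrow> (\<exists>r'<5. 0 < x ! r' \<and> k + (r - r') + (r' - r) \<le> x ! r')"

lemma covers_code [code]:
  "covers k x r = list_ex (\<lambda>r'. 0 < x ! r' \<and> k + (r - r') + (r' - r) \<le> x ! r') [0..<5]"
  by (auto simp: covers_def list_ex_iff)

definition mask :: "nat \<Rightarrow> nat list \<Rightarrow> bool list" where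
  "mask k x = map (covers k x) [0..<5]"

type_synonym masks = "bool list \<times> bool list \<times> bool list"

definition masks :: "nat list \<Rightarrow> masks" where
  "masks x = (mask 0 x, mask 1 x, mask 2 x)"

type_synonym state = "bool list \<times> bool list \<times> bool list \<times> bool list"

text \<open>
  In a state \<open>(A, B, U, W)\<close> the columns read so far cover the rows \<open>A\<close> of the next column and
  the rows \<open>B\<close> of the one after it; they leave the rows \<open>U\<close> of the last column and the rows
  \<open>W\<close> of the last but one uncovered.
\<close>

fun step :: "state \<Rightarrow> masks \<Rightarrow> state" where
  "step (A, B, U, W) (m0, m1, m2) =
     (map2 (\<or>) B m1, m2, map2 (\<lambda>a b. \<not> a \<and> \<not> b) A m0, map2 (\<lambda>a b. a \<and> \<not> b) U m1)"

text \<open>A broadcast reaches at most two columns, so the column being read is the last one that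
  can cover the rows in \<open>W\<close>.\<close>

fun admissible :: "state \<Rightarrow> masks \<Rightarrow> bool" where
  "admissible (A, B, U, W) (m0, m1, m2) = list_all2 (\<longrightarrow>) W m2"

text \<open>Declares the next two columns covered and leaves nothing pending, so reading may begin
  anywhere on the cycle.\<close>

definition free_state :: state where
  "free_state = (map (\<lambda>_. True) [0..<5], map (\<lambda>_. True) [0..<5],
     map (\<lambda>_. False) [0..<5], map (\<lambda>_. False) [0..<5])"

primrec run :: "(nat \<Rightarrow> nat list) \<Rightarrow> nat \<Rightarrow> state" where
  "run x 0 = free_state"
| "run x (Suc m) = step (run x m) (masks (x m))"

definition window_state :: "nat list \<Rightarrow> nat list \<Rightarrow> nat list \<Rightarrow> nat list \<Rightarrow> state" where
  "window_state x0 x1 x2 x3 =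
     (map (\<lambda>r. covers 2 x2 r \<or> covers 1 x3 r) [0..<5],
      map (covers 2 x3) [0..<5],
      map (\<lambda>r. \<not> (covers 2 x1 r \<or> covers 1 x2 r) \<and> \<not> covers 0 x3 r) [0..<5],
      map (\<lambda>r. (\<not> (covers 2 x0 r \<or> covers 1 x1 r) \<and> \<not> covers 0 x2 r) \<and> \<not> covers 1 x3 r)
        [0..<5])"

text \<open>Every trace of \<open>s\<close> is gone after four steps. This is what turns periodic
  columns into periodic states.\<close>

lemma step_four:
  "step (step (step (step s (masks x0)) (masks x1)) (masks x2)) (masks x3) =
     window_state x0 x1 x2 x3"
  by (cases s) (simp add: masks_def mask_def window_state_def map2_map_map del: upt_Suc)

lemma run_eq_window_state:
  "run x (m + 4) = window_state (x m) (x (m + 1)) (x (m + 2)) (x (m + 3))"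
proof -
  have "run x (m + 4) = step (step (step (step (run x m) (masks (x m))) (masks (x (m + 1))))
      (masks (x (m + 2)))) (masks (x (m + 3)))"
    by (simp add: eval_nat_numeral)
  then show ?thesis
    by (simp only: step_four)
qed

text \<open>For \<open>m < 4\<close> the set \<open>W\<close> is empty, as \<open>free_state\<close>
  declares the first two columns covered. Later \<open>W\<close> concerns column
  \<open>m - 2\<close>, whose domination is \<open>dom\<close> at \<open>m - 4\<close>.\<close>

lemma run_admissible:
  assumes dom: "\<And>j r. r < 5 \<Longrightarrow> covers 2 (x j) r \<or> covers 1 (x (j + 1)) r \<or>
    covers 0 (x (j + 2)) r \<or> covers 1 (x (j + 3)) r \<or> covers 2 (x (j + 4)) r"
  shows "admissible (run x m) (masks (x m))"
proof (cases "m < 4")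
  case True
  then have "m \<in> {0, 1, 2, 3}"
    by auto
  then show ?thesis
    by (auto simp: free_state_def masks_def mask_def map2_map_map list_all2_conv_all_nth
        eval_nat_numeral simp del: upt_Suc)
next
  case False
  then obtain k where m: "m = k + 4"
    by (metis add.commute le_Suc_ex not_less)
  show ?thesis
    unfolding m run_eq_window_state window_state_def masks_def mask_def
    using dom[of _ k] by (auto simp: list_all2_conv_all_nth simp del: upt_Suc)
qed

fun rows5 :: "state \<Rightarrow> bool" where
  "rows5 (A, B, U, W) \<longleftrightarrow> length A = 5 \<and> length B = 5 \<and> length U = 5 \<and> length W = 5"

lemma rows5_run: "rows5 (run x m)"
proof (induction m)
  case (Suc m)
  then show ?case by (cases "run x m") (simp add: masks_def mask_def)
qed (simp add: free_state_def)

section \<open>The certificate\<close>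

fun key :: "state \<Rightarrow> bool list" where
  "key (A, B, U, W) = A @ B @ U @ W"

lemma key_inject: "rows5 s \<Longrightarrow> rows5 s' \<Longrightarrow> key s = key s' \<Longrightarrow> s = s'"
  by (cases s; cases s') simp

fun bits :: "int \<Rightarrow> bool list" where
  "bits m = [odd m, odd (m div 2), odd (m div 4), odd (m div 8), odd (m div 16)]"

text \<open>Grouped by cost, so that the bound on the potential is tested once per group. Costs up
  to 5 suffice: no potential is below -60, and \<open>-60 + 15 * (6 - 1) > 14\<close>.\<close>

definition columns :: "(int \<times> masks list) list" where
  "columns = map (\<lambda>c. (int c, map masks
     (filter (\<lambda>x. sum_list x = c) (product_lists (replicate 5 [0,1,2]))))) [0..<6]"

text \<open>
  An entry \<open>(a, b, u, w, p, q)\<close> lists a state by the binary codes of its four row sets. The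
  entries are all states that are reachable from \<^const>\<open>free_state\<close> while the excess, cost minus
  number of columns read, stays nonpositive. The potential is \<open>p = 15 * e + h\<close>, where \<open>e\<close> is the
  least excess with which the state is reached and \<open>0 \<le> h < 15\<close> is its height in the graph of
  those transitions along which \<open>e\<close> changes by exactly the excess of the column read, with
  strongly connected components contracted. All components are bipartite, and \<open>q\<close> is a
  2-colouring of them.
\<close>

definition certificate :: "(int \<times> int \<times> int \<times> int \<times> int \<times> int) list" where
  "certificate =
    [(0,0,0,0,-18,0), (0,0,3,0,-14,0), (0,0,3,1,-15,0), (0,0,5,0,-14,0), (0,0,6,0,-14,0),
    (0,0,7,0,-14,0), (0,0,7,1,-29,0), (0,0,7,2,-15,0), (0,0,7,3,-30,0), (0,0,9,0,-14,0),
    (0,0,10,0,-14,0), (0,0,11,0,-14,0), (0,0,11,1,-22,0), (0,0,12,0,-14,0), (0,0,13,0,-23,0),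
    (0,0,14,0,-20,0), (0,0,14,4,-20,0), (0,0,15,0,-23,0), (0,0,15,1,-29,0), (0,0,15,2,-23,0),
    (0,0,15,3,-30,0), (0,0,15,4,-25,0), (0,0,15,5,-30,0), (0,0,15,6,-30,0), (0,0,15,7,-45,0),
    (0,0,17,0,-14,0), (0,0,18,0,-14,0), (0,0,19,0,-14,0), (0,0,19,1,-24,0), (0,0,20,0,-14,0),
    (0,0,21,0,-23,0), (0,0,22,0,-23,0), (0,0,23,0,-23,0), (0,0,23,1,-29,0), (0,0,23,2,-24,1),
    (0,0,23,3,-44,0), (0,0,24,0,-14,0), (0,0,24,16,-15,0), (0,0,25,0,-14,0), (0,0,25,16,-24,0),
    (0,0,26,0,-14,0), (0,0,26,16,-22,0), (0,0,27,0,-29,0), (0,0,27,1,-29,0), (0,0,27,16,-29,0),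
    (0,0,27,17,-35,1), (0,0,28,0,-14,0), (0,0,28,8,-15,0), (0,0,28,16,-29,0), (0,0,28,24,-30,0),
    (0,0,29,0,-23,0), (0,0,29,8,-24,0), (0,0,29,16,-29,0), (0,0,29,24,-44,0), (0,0,30,0,-23,0),
    (0,0,30,4,-25,0), (0,0,30,8,-23,0), (0,0,30,12,-30,0), (0,0,30,16,-29,0), (0,0,30,20,-30,0),
    (0,0,30,24,-30,0), (0,0,30,28,-45,0), (0,0,31,0,-35,0), (0,0,31,3,-30,0), (0,0,31,5,-30,0),
    (0,0,31,6,-30,0), (0,0,31,7,-30,0), (0,0,31,9,-30,0), (0,0,31,10,-30,0), (0,0,31,11,-30,0),
    (0,0,31,12,-30,0), (0,0,31,13,-45,0), (0,0,31,14,-45,0), (0,0,31,15,-45,0), (0,0,31,17,-30,0),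
    (0,0,31,18,-30,0), (0,0,31,19,-30,0), (0,0,31,20,-30,0), (0,0,31,21,-45,0), (0,0,31,22,-45,0),
    (0,0,31,23,-45,0), (0,0,31,24,-30,0), (0,0,31,25,-30,0), (0,0,31,26,-30,0), (0,0,31,27,-45,0),
    (0,0,31,28,-30,0), (0,0,31,29,-45,0), (0,0,31,30,-45,0), (0,0,31,31,-60,0), (1,0,0,0,-7,0),
    (1,0,4,0,-9,0), (1,0,4,2,-15,0), (1,0,8,0,-7,0), (1,0,12,0,-12,0), (1,0,12,2,-15,0),
    (1,0,12,4,-15,0), (1,0,12,6,-30,0), (1,0,16,0,-11,0), (1,0,20,0,-12,0), (1,0,20,2,-23,0),
    (1,0,24,0,-13,0), (1,0,24,16,-20,1), (1,0,28,0,-19,0), (1,0,28,2,-15,0), (1,0,28,4,-15,0),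
    (1,0,28,6,-15,0), (1,0,28,8,-20,1), (1,0,28,10,-15,0), (1,0,28,12,-30,0), (1,0,28,14,-30,0),
    (1,0,28,16,-24,0), (1,0,28,18,-15,0), (1,0,28,20,-30,0), (1,0,28,22,-30,0), (1,0,28,24,-30,0),
    (1,0,28,26,-30,0), (1,0,28,28,-30,0), (1,0,28,30,-45,0), (2,0,0,0,-7,0), (2,0,0,1,-15,0),
    (2,0,8,0,-9,1), (2,0,8,1,-15,0), (2,0,8,4,-15,0), (2,0,8,5,-30,0), (2,0,16,0,-11,0),
    (2,0,16,1,-24,0), (2,0,24,0,-20,1), (2,0,24,1,-15,0), (2,0,24,4,-15,0), (2,0,24,5,-15,0),
    (2,0,24,8,-15,0), (2,0,24,9,-15,0), (2,0,24,12,-30,0), (2,0,24,13,-30,0), (2,0,24,16,-20,1),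
    (2,0,24,17,-30,0), (2,0,24,20,-30,0), (2,0,24,21,-30,0), (2,0,24,24,-30,0), (2,0,24,25,-30,0),
    (2,0,24,28,-30,0), (2,0,24,29,-45,0), (3,0,0,0,2,0), (3,0,8,0,1,0), (3,0,8,4,-15,0),
    (3,0,16,0,-8,0), (3,0,24,0,-12,0), (3,0,24,4,0,0), (3,0,24,8,-15,0), (3,0,24,12,-15,0),
    (3,0,24,16,-14,0), (3,0,24,20,-15,0), (3,0,24,24,-15,0), (3,0,24,28,-30,0), (3,1,0,0,0,0),
    (3,1,8,0,-5,0), (3,1,8,4,-10,0), (3,1,16,0,-5,0), (3,1,24,0,-8,0), (3,1,24,4,-15,0),
    (3,1,24,8,-8,0), (3,1,24,12,-15,0), (3,1,24,16,-10,0), (3,1,24,20,-15,0), (3,1,24,24,-15,0),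
    (3,1,24,28,-30,0), (4,0,0,0,-12,0), (4,0,1,0,-12,0), (4,0,1,1,-15,0), (4,0,1,2,-15,0),
    (4,0,1,3,-30,0), (4,0,16,0,-12,0), (4,0,16,8,-15,0), (4,0,16,16,-15,0), (4,0,16,24,-30,0),
    (4,0,17,0,-20,0), (4,0,17,1,-15,0), (4,0,17,2,-15,0), (4,0,17,3,-30,0), (4,0,17,8,-15,0),
    (4,0,17,9,-30,0), (4,0,17,10,-30,0), (4,0,17,11,-30,0), (4,0,17,16,-15,0), (4,0,17,17,-30,0),
    (4,0,17,18,-30,0), (4,0,17,19,-30,0), (4,0,17,24,-30,0), (4,0,17,25,-30,0), (4,0,17,26,-30,0),
    (4,0,17,27,-45,0), (5,0,0,0,2,0), (5,0,0,2,-15,0), (5,0,16,0,-6,0), (5,0,16,2,-15,0),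
    (5,0,16,8,-15,0), (5,0,16,10,-15,0), (5,0,16,16,-15,0), (5,0,16,18,-15,0), (5,0,16,24,-15,0),
    (5,0,16,26,-30,0), (6,0,0,0,2,0), (6,0,0,1,-15,0), (6,0,16,0,-8,0), (6,0,16,1,-15,0),
    (6,0,16,8,-15,0), (6,0,16,9,-15,0), (6,0,16,16,-15,0), (6,0,16,17,-15,0), (6,0,16,24,-15,0),
    (6,0,16,25,-30,0), (7,0,0,0,2,0), (7,0,16,0,1,0), (7,0,16,8,0,0), (7,0,16,16,0,0),
    (7,0,16,24,-15,0), (7,1,0,0,3,0), (7,1,16,0,0,0), (7,1,16,8,0,0), (7,1,16,16,0,0),
    (7,1,16,24,-15,0), (7,2,0,0,-5,0), (7,2,16,0,-5,0), (7,2,16,8,-9,0), (7,2,16,16,-10,0),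
    (7,2,16,24,-30,0), (7,3,16,16,0,0), (7,3,16,24,0,0), (8,0,0,0,-7,0), (8,0,0,16,-15,0),
    (8,0,1,0,-11,0), (8,0,1,16,-24,0), (8,0,2,0,-9,0), (8,0,2,4,-15,0), (8,0,2,16,-15,0),
    (8,0,2,20,-30,0), (8,0,3,0,-20,1), (8,0,3,1,-20,1), (8,0,3,2,-15,0), (8,0,3,3,-30,0),
    (8,0,3,4,-15,0), (8,0,3,5,-30,0), (8,0,3,6,-30,0), (8,0,3,7,-30,0), (8,0,3,16,-15,0),
    (8,0,3,17,-30,0), (8,0,3,18,-15,0), (8,0,3,19,-30,0), (8,0,3,20,-15,0), (8,0,3,21,-30,0),
    (8,0,3,22,-30,0), (8,0,3,23,-45,0), (9,0,0,0,-7,0), (9,0,0,2,-15,0), (9,0,0,4,-15,0),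
    (9,0,0,6,-15,0), (9,0,0,16,-15,0), (9,0,0,18,-15,0), (9,0,0,20,-15,0), (9,0,0,22,-30,0),
    (10,0,0,0,-7,0), (10,0,0,1,-15,0), (10,0,0,4,-15,0), (10,0,0,5,-15,0), (10,0,0,16,-15,0),
    (10,0,0,17,-15,0), (10,0,0,20,-15,0), (10,0,0,21,-30,0), (11,0,0,0,2,0), (11,0,0,4,0,0),
    (11,0,0,16,0,0), (11,0,0,20,-15,0), (11,1,0,0,4,0), (11,1,0,4,0,0), (11,1,0,16,0,0),
    (11,1,0,20,-15,0), (12,0,0,0,2,0), (12,0,0,16,-15,0), (12,0,1,0,-8,0), (12,0,1,1,-15,0),
    (12,0,1,2,-15,0), (12,0,1,3,-15,0), (12,0,1,16,-15,0), (12,0,1,17,-15,0), (12,0,1,18,-15,0),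
    (12,0,1,19,-30,0), (13,0,0,0,2,0), (13,0,0,2,0,0), (13,0,0,16,0,0), (13,0,0,18,-15,0),
    (14,0,0,0,2,0), (14,0,0,1,0,0), (14,0,0,16,0,0), (14,0,0,17,-15,0), (14,4,0,0,-5,1),
    (14,4,0,1,-14,0), (14,4,0,16,-14,0), (14,4,0,17,-30,0), (15,0,0,16,0,0), (15,1,0,16,0,0),
    (15,2,0,0,5,0), (15,2,0,16,-10,0), (15,4,0,0,4,0), (15,4,0,16,-11,0), (15,5,0,16,0,0),
    (15,6,0,16,0,0), (16,0,0,0,-7,0), (16,0,1,0,-11,0), (16,0,2,0,-7,0), (16,0,3,0,-13,0),
    (16,0,3,1,-20,1), (16,0,4,0,-9,0), (16,0,4,8,-15,0), (16,0,5,0,-12,0), (16,0,5,8,-23,0),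
    (16,0,6,0,-12,0), (16,0,6,4,-15,0), (16,0,6,8,-15,0), (16,0,6,12,-30,0), (16,0,7,0,-19,0),
    (16,0,7,1,-24,0), (16,0,7,2,-20,1), (16,0,7,3,-30,0), (16,0,7,4,-15,0), (16,0,7,5,-30,0),
    (16,0,7,6,-30,0), (16,0,7,7,-30,0), (16,0,7,8,-15,0), (16,0,7,9,-15,0), (16,0,7,10,-15,0),
    (16,0,7,11,-30,0), (16,0,7,12,-15,0), (16,0,7,13,-30,0), (16,0,7,14,-30,0), (16,0,7,15,-45,0),
    (17,0,0,0,-5,1), (17,0,4,0,-5,1), (17,0,4,2,-15,0), (17,0,4,4,-15,0), (17,0,4,6,-15,0),
    (17,0,4,8,-15,0), (17,0,4,10,-15,0), (17,0,4,12,-15,0), (17,0,4,14,-30,0), (18,0,0,0,-7,0),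
    (18,0,0,1,-15,0), (18,0,0,4,-15,0), (18,0,0,5,-15,0), (18,0,0,8,-15,0), (18,0,0,9,-15,0),
    (18,0,0,12,-15,0), (18,0,0,13,-30,0), (19,0,0,0,2,0), (19,0,0,4,0,0), (19,0,0,8,0,0),
    (19,0,0,12,-15,0), (19,1,0,0,4,0), (19,1,0,4,0,0), (19,1,0,8,0,0), (19,1,0,12,-15,0),
    (20,0,0,0,2,0), (20,0,0,8,-15,0), (20,0,1,0,-6,0), (20,0,1,1,-15,0), (20,0,1,2,-15,0),
    (20,0,1,3,-15,0), (20,0,1,8,-15,0), (20,0,1,9,-15,0), (20,0,1,10,-15,0), (20,0,1,11,-30,0),
    (21,0,0,0,2,0), (21,0,0,2,0,0), (21,0,0,8,0,0), (21,0,0,10,-15,0), (22,0,0,0,2,0),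
    (22,0,0,1,0,0), (22,0,0,8,0,0), (22,0,0,9,-15,0), (23,0,0,8,0,0), (23,1,0,8,0,0),
    (23,2,0,0,6,0), (23,2,0,8,-9,0), (24,0,0,0,2,0), (24,0,1,0,-8,0), (24,0,2,0,1,0),
    (24,0,2,4,-15,0), (24,0,3,0,-12,0), (24,0,3,1,-14,0), (24,0,3,2,-15,0), (24,0,3,3,-15,0),
    (24,0,3,4,0,0), (24,0,3,5,-15,0), (24,0,3,6,-15,0), (24,0,3,7,-30,0), (24,16,0,0,0,0),
    (24,16,1,0,-5,0), (24,16,2,0,-5,0), (24,16,2,4,-10,0), (24,16,3,0,-8,0), (24,16,3,1,-10,0),
    (24,16,3,2,-8,0), (24,16,3,3,-15,0), (24,16,3,4,-15,0), (24,16,3,5,-15,0), (24,16,3,6,-15,0),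
    (24,16,3,7,-30,0), (25,0,0,0,2,0), (25,0,0,2,0,0), (25,0,0,4,0,0), (25,0,0,6,-15,0),
    (25,16,0,0,4,0), (25,16,0,2,0,0), (25,16,0,4,0,0), (25,16,0,6,-15,0), (26,0,0,0,2,0),
    (26,0,0,1,0,0), (26,0,0,4,0,0), (26,0,0,5,-15,0), (26,16,0,0,4,0), (26,16,0,1,0,0),
    (26,16,0,4,0,0), (26,16,0,5,-15,0), (27,0,0,4,0,0), (27,1,0,4,0,0), (27,16,0,4,0,0),
    (27,17,0,0,10,0), (27,17,0,4,0,0), (28,0,0,0,2,0), (28,0,1,0,1,0), (28,0,1,1,0,0),
    (28,0,1,2,0,0), (28,0,1,3,-15,0), (28,8,0,0,-5,0), (28,8,1,0,-5,0), (28,8,1,1,-10,0),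
    (28,8,1,2,-9,0), (28,8,1,3,-30,0), (28,16,0,0,3,0), (28,16,1,0,0,0), (28,16,1,1,0,0),
    (28,16,1,2,0,0), (28,16,1,3,-15,0), (28,24,1,1,0,0), (28,24,1,3,0,0), (29,0,0,2,0,0),
    (29,8,0,0,6,1), (29,8,0,2,-9,0), (29,16,0,2,0,0), (30,0,0,1,0,0), (30,4,0,0,4,0),
    (30,4,0,1,-11,0), (30,8,0,0,5,0), (30,8,0,1,-10,0), (30,12,0,1,0,0), (30,16,0,1,0,0),
    (30,20,0,1,0,0), (31,0,0,0,-2,0), (31,2,0,0,9,0), (31,4,0,0,4,0), (31,8,0,0,9,0),
    (31,9,0,0,9,0), (31,10,0,0,9,0), (31,18,0,0,9,0), (31,31,0,0,14,0)]"

definition entries :: "(state \<times> int \<times> bool) list" where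
  "entries = map (\<lambda>(a, b, u, w, p, q). ((bits a, bits b, bits u, bits w), p, q = 1)) certificate"

definition entry_trie :: "(int \<times> bool) trie" where
  "entry_trie = trie_of (map (\<lambda>(s, v). (key s, v)) entries)"

fun edge_ok :: "(int \<times> bool) option \<Rightarrow> int \<Rightarrow> bool \<Rightarrow> bool" where
  "edge_ok None p q = False"
| "edge_ok (Some (p', q')) p q \<longleftrightarrow> p' < p \<or> p' = p \<and> q' \<noteq> q"

fun check_columns :: "(int \<times> bool) trie \<Rightarrow> state \<Rightarrow> int \<Rightarrow> bool \<Rightarrow> masks list \<Rightarrow> bool" where
  "check_columns t s p q [] \<longleftrightarrow> True"
| "check_columns t s p q (x # xs) \<longleftrightarrow>
     edge_ok (trie_lookup t (key (step s x))) p q \<and> check_columns t s p q xs"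

text \<open>14 is the largest value of \<open>15 * e + h\<close> with \<open>e \<le> 0\<close> and
  \<open>h < 15\<close>; transitions beyond it do not occur on a run whose excess stays
  nonpositive.\<close>

fun check_costs ::
  "(int \<times> bool) trie \<Rightarrow> state \<Rightarrow> int \<Rightarrow> bool \<Rightarrow> (int \<times> masks list) list \<Rightarrow> bool" where
  "check_costs t s p q [] \<longleftrightarrow> True"
| "check_costs t s p q ((c, xs) # cs) \<longleftrightarrow>
     check_columns t s (p + 15 * (c - 1)) q
       (if p + 15 * (c - 1) \<le> 14 then filter (admissible s) xs else [])
     \<and> check_costs t s p q cs"

fun check_entries ::
  "(int \<times> bool) trie \<Rightarrow> (int \<times> masks list) list \<Rightarrow> (state \<times> int \<times> bool) list \<Rightarrow> bool" where
  "check_entries t cs [] \<longleftrightarrow> True"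
| "check_entries t cs ((s, p, q) # es) \<longleftrightarrow> check_costs t s p q cs \<and> check_entries t cs es"

text \<open>The whole finite case analysis: the table is closed under the transitions considered,
  and each successor has potential below \<open>p + 15 * (c - 1)\<close>, or equal to it with the
  other colour.\<close>

lemma entries_checked: "check_entries entry_trie columns entries"
  by code_simp

lemma potential_ge: "e \<in> set entries \<Longrightarrow> - 60 \<le> fst (snd e)"
proof -
  have "list_all (\<lambda>e. - 60 \<le> fst (snd e)) entries"
    by code_simp
  then show "e \<in> set entries \<Longrightarrow> - 60 \<le> fst (snd e)"
    by (auto simp: list_all_iff)
qed

definition certified :: "state \<Rightarrow> (int \<times> bool) option" where
  "certified s = trie_lookup entry_trie (key s)"

lemma certified_free_state: "\<exists>q. certified free_state = Some (14, q)"
proof -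
  have "certified free_state = Some (14, False)"
    by code_simp
  then show ?thesis ..
qed

lemma certified_in_entries:
  assumes "certified s = Some (p, q)" and "rows5 s"
  shows "(s, p, q) \<in> set entries"
proof -
  have "(key s, p, q) \<in> set (map (\<lambda>(s, v). (key s, v)) entries)"
    using assms(1) unfolding certified_def entry_trie_def by (rule trie_lookup_of)
  then obtain s' where s': "(s', p, q) \<in> set entries" "key s = key s'"
    by auto
  then have "rows5 s'"
    unfolding entries_def by auto
  then show ?thesis
    using key_inject[OF assms(2) _ s'(2)] s'(1) by simp
qed

lemma check_columnsD:
  "check_columns t s p q xs \<Longrightarrow> x \<in> set xs \<Longrightarrow> edge_ok (trie_lookup t (key (step s x))) p q"
  by (induction xs) auto

lemma check_costsD:
  assumes "check_costs t s p q cs" and "(c, xs) \<in> set cs" and "p + 15 * (c - 1) \<le> 14"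
    and "x \<in> set xs" and "admissible s x"
  shows "edge_ok (trie_lookup t (key (step s x))) (p + 15 * (c - 1)) q"
  using assms
proof (induction t s p q cs rule: check_costs.induct)
  case (2 t s p q c' xs' cs)
  show ?case
  proof (cases "(c, xs) = (c', xs')")
    case True
    then have "check_columns t s (p + 15 * (c - 1)) q (filter (admissible s) xs)"
      using "2.prems" by simp
    then show ?thesis
      by (rule check_columnsD) (use "2.prems" in simp)
  next
    case False
    then show ?thesis
      using "2.prems" "2.IH" by auto
  qed
qed simp

lemma check_entriesD:
  "check_entries t cs es \<Longrightarrow> (s, p, q) \<in> set es \<Longrightarrow> check_costs t s p q cs"
  by (induction t cs es rule: check_entries.induct) auto

lemma masks_in_columns:
  assumes "length x = 5" and "set x \<subseteq> {0, 1, 2}" and "sum_list x < 6"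
  shows "\<exists>xs. (int (sum_list x), xs) \<in> set columns \<and> masks x \<in> set xs"
proof -
  have "list_all2 (\<lambda>y ys. y \<in> set ys) x (replicate 5 [0, 1, 2])"
  proof (rule list_all2_all_nthI)
    fix i assume "i < length x"
    then have "x ! i \<in> {0, 1, 2}"
      using assms(2) nth_mem by blast
    then show "x ! i \<in> set (replicate 5 [0, 1, 2] ! i)"
      using \<open>i < length x\<close> assms(1) by simp
  qed (use assms(1) in simp)
  then have "x \<in> set (product_lists (replicate 5 [0, 1, 2]))"
    by (simp only: product_lists_set mem_Collect_eq)
  then have "masks x \<in> set (map masks
      (filter (\<lambda>y. sum_list y = sum_list x) (product_lists (replicate 5 [0, 1, 2]))))"
      (is "_ \<in> set ?xs")
    unfolding set_map set_filter by blast
  moreover have "(int (sum_list x), ?xs) \<in> set columns"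
    unfolding columns_def set_map by (rule image_eqI[OF refl]) (use assms(3) in simp)
  ultimately show ?thesis
    by blast
qed

lemma certified_step:
  assumes "certified s = Some (p, q)" and "rows5 s"
    and "length x = 5" and "set x \<subseteq> {0, 1, 2}" and "admissible s (masks x)"
    and le: "p + 15 * (int (sum_list x) - 1) \<le> 14"
  shows "edge_ok (certified (step s (masks x))) (p + 15 * (int (sum_list x) - 1)) q"
proof -
  have e: "(s, p, q) \<in> set entries"
    using assms(1,2) by (rule certified_in_entries)
  have "sum_list x < 6"
  proof (rule ccontr)
    assume "\<not> sum_list x < 6"
    then have "6 \<le> int (sum_list x)"
      by simp
    then show False
      using potential_ge[OF e] le by simp
  qed
  then obtain xs where "(int (sum_list x), xs) \<in> set columns" "masks x \<in> set xs"
    using masks_in_columns assms(3,4) by blast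
  then show ?thesis
    unfolding certified_def
    using check_costsD check_entriesD[OF entries_checked e] assms(5) le by blast
qed

section \<open>Periodic sequences of columns\<close>

lemma edge_okE:
  assumes "edge_ok v p q"
  obtains p' q' where "v = Some (p', q')" "p' \<le> p" "p' = p \<Longrightarrow> q' \<noteq> q"
  using assms by (cases v) force+

text \<open>By induction the potential is at most 14 plus 15 times the current excess. As the excess
  is still nonpositive after the next column, the bound 14 in \<open>certified_step\<close> is met
  and the run never leaves the table.\<close>

lemma certified_run:
  assumes col: "\<And>j. length (y j) = 5" "\<And>j. set (y j) \<subseteq> {0, 1, 2}"
    and dom: "\<And>j r. r < 5 \<Longrightarrow> covers 2 (y j) r \<or> covers 1 (y (j + 1)) r \<or>
      covers 0 (y (j + 2)) r \<or> covers 1 (y (j + 3)) r \<or> covers 2 (y (j + 4)) r"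
    and excess: "\<And>m. (\<Sum>i<m. int (sum_list (y i)) - 1) \<le> 0"
  obtains P Q where "\<And>m. certified (run y m) = Some (P m, Q m)"
    and "\<And>m. P (Suc m) \<le> P m + 15 * (int (sum_list (y m)) - 1)"
    and "\<And>m. P (Suc m) = P m + 15 * (int (sum_list (y m)) - 1) \<Longrightarrow> Q (Suc m) \<noteq> Q m"
proof -
  have edge: "edge_ok (certified (run y (Suc m))) (p + 15 * (int (sum_list (y m)) - 1)) q"
    if "certified (run y m) = Some (p, q)" and "p \<le> 14 + 15 * (\<Sum>i<m. int (sum_list (y i)) - 1)"
    for m p q
  proof -
    have "p + 15 * (int (sum_list (y m)) - 1)
        \<le> 14 + 15 * (\<Sum>i<Suc m. int (sum_list (y i)) - 1)"
      using that(2) unfolding sum.lessThan_Suc distrib_left by linarith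
    then have "p + 15 * (int (sum_list (y m)) - 1) \<le> 14"
      using excess[of "Suc m"] by linarith
    then show ?thesis
      unfolding run.simps
      using certified_step that(1) rows5_run col run_admissible[OF dom] by blast
  qed
  have inv: "\<exists>p q. certified (run y m) = Some (p, q)
      \<and> p \<le> 14 + 15 * (\<Sum>i<m. int (sum_list (y i)) - 1)" for m
  proof (induction m)
    case 0
    then show ?case
      using certified_free_state by auto
  next
    case (Suc m)
    then obtain p q where pq: "certified (run y m) = Some (p, q)"
      "p \<le> 14 + 15 * (\<Sum>i<m. int (sum_list (y i)) - 1)"
      by blast
    from edge[OF this] obtain p' q' where p': "certified (run y (Suc m)) = Some (p', q')"
      "p' \<le> p + 15 * (int (sum_list (y m)) - 1)"
      by (rule edge_okE)
    have "p' \<le> 14 + 15 * (\<Sum>i<Suc m. int (sum_list (y i)) - 1)"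
      using pq(2) p'(2) unfolding sum.lessThan_Suc distrib_left by linarith
    then show ?case
      using p'(1) by blast
  qed
  define P where "P m = fst (the (certified (run y m)))" for m
  define Q where "Q m = snd (the (certified (run y m)))" for m
  have cert: "certified (run y m) = Some (P m, Q m)" for m
    using inv[of m] by (auto simp: P_def Q_def)
  have "P m \<le> 14 + 15 * (\<Sum>i<m. int (sum_list (y i)) - 1)" for m
    using inv[of m] cert[of m] by auto
  then have ok: "edge_ok (Some (P (Suc m), Q (Suc m)))
      (P m + 15 * (int (sum_list (y m)) - 1)) (Q m)" for m
    using edge[OF cert[of m]] unfolding cert[of "Suc m"] by blast
  show thesis
  proof (rule that[OF cert])
    show "P (Suc m) \<le> P m + 15 * (int (sum_list (y m)) - 1)" for m
      using ok[of m] unfolding edge_ok.simps by linarith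
    show "Q (Suc m) \<noteq> Q m" if "P (Suc m) = P m + 15 * (int (sum_list (y m)) - 1)" for m
      using ok[of m] that unfolding edge_ok.simps by simp
  qed
qed

text \<open>Reading starts where the partial excess \<open>S\<close> is maximal; from there every
  initial segment has nonpositive excess, as \<open>certified_run\<close> requires.\<close>

lemma periodic_columns_cost:
  fixes n :: nat
  assumes "0 < n"
    and col: "\<And>j. length (x j) = 5" "\<And>j. set (x j) \<subseteq> {0, 1, 2}"
    and per: "\<And>j. x (j + n) = x j"
    and dom: "\<And>j r. r < 5 \<Longrightarrow> covers 2 (x j) r \<or> covers 1 (x (j + 1)) r \<or>
      covers 0 (x (j + 2)) r \<or> covers 1 (x (j + 3)) r \<or> covers 2 (x (j + 4)) r"
    and cost: "(\<Sum>j<n. sum_list (x j)) \<le> n"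
  shows "(\<Sum>j<n. sum_list (x j)) = n" and "even n"
proof -
  define c where "c j = int (sum_list (x j)) - 1" for j
  define S where "S j = (\<Sum>i<j. c i)" for j
  have S_Suc: "S (Suc j) = S j + c j" for j
    by (simp add: S_def)
  have S_add_n: "S (j + n) = S j + S n" for j
  proof (induction j)
    case (Suc j)
    then show ?case
      using S_Suc[of "j + n"] S_Suc[of j] per[of j] by (simp add: c_def)
  qed (simp add: S_def)
  have S_n: "S n = int (\<Sum>j<n. sum_list (x j)) - int n"
    by (simp add: S_def c_def sum_subtractf)
  then have "S n \<le> 0"
    using cost by linarith
  obtain j0 where "j0 < n" and max: "\<And>j. j < n \<Longrightarrow> S j \<le> S j0"
  proof -
    have "Max (S ` {..<n}) \<in> S ` {..<n}"
      using \<open>0 < n\<close> by (intro Max_in) auto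
    then obtain j0 where j0: "j0 < n" "S j0 = Max (S ` {..<n})"
      by auto
    have "S j \<le> S j0" if "j < n" for j
      using that unfolding j0(2) by (intro Max_ge) auto
    then show thesis
      using that j0(1) by blast
  qed
  \<comment> \<open>Since \<open>S n \<le> 0\<close>, going back by a whole period never lowers
    \<open>S\<close>, so the maximum over one period is global.\<close>
  have max_all: "S j \<le> S j0" for j
  proof (induction j rule: less_induct)
    case (less j)
    show ?case
    proof (cases "j < n")
      case False
      then have "S j = S (j - n) + S n"
        using S_add_n[of "j - n"] by simp
      then show ?thesis
        using less[of "j - n"] False \<open>0 < n\<close> \<open>S n \<le> 0\<close> by auto
    qed (rule max)
  qed
  define y where "y m = x (j0 + m)" for m
  have c_y: "c (j0 + m) = int (sum_list (y m)) - 1" for m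
    by (simp add: c_def y_def)
  have sum_y: "(\<Sum>i<m. int (sum_list (y i)) - 1) = S (j0 + m) - S j0" for m
    by (induction m) (simp_all add: S_Suc y_def c_def)
  obtain P Q where cert: "\<And>m. certified (run y m) = Some (P m, Q m)"
    and P_le: "\<And>m. P (Suc m) \<le> P m + 15 * (int (sum_list (y m)) - 1)"
    and Q_flip: "\<And>m. P (Suc m) = P m + 15 * (int (sum_list (y m)) - 1) \<Longrightarrow> Q (Suc m) \<noteq> Q m"
  proof (rule certified_run[of y])
    show "(\<Sum>i<m. int (sum_list (y i)) - 1) \<le> 0" for m
      unfolding sum_y using max_all by simp
    show "covers 2 (y j) r \<or> covers 1 (y (j + 1)) r \<or> covers 0 (y (j + 2)) r
        \<or> covers 1 (y (j + 3)) r \<or> covers 2 (y (j + 4)) r" if "r < 5" for j r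
      using dom[OF that, of "j0 + j"] by (simp add: y_def add.assoc)
  qed (use col in \<open>auto simp: y_def\<close>)
  \<comment> \<open>The states are determined by the last four columns, so from position 4 on they inherit the
    period of the columns.\<close>
  have "y (m + n) = y m" for m
    using per[of "j0 + m"] by (simp add: y_def add.assoc)
  from this[of 0] this[of 1] this[of 2] this[of 3] have "run y (n + 4) = run y (0 + 4)"
    unfolding run_eq_window_state by (simp add: add.commute numeral_2_eq_2)
  then have PQ_n: "P (n + 4) = P 4" "Q (n + 4) = Q 4"
    using cert[of "n + 4"] cert[of 4] by simp_all
  \<comment> \<open>\<open>D\<close> is the potential corrected by the accumulated excess. It never
    increases, yet over one period it changes by exactly \<open>- 15 * S n\<close>; hence
    \<open>S n\<close> is not negative.\<close>
  define D where "D k = P (k + 4) - 15 * S (j0 + (k + 4))" for k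
  have "D (Suc k) \<le> D k" for k
    using P_le[of "k + 4"] S_Suc[of "j0 + (k + 4)"]
    unfolding D_def c_y[symmetric] add_Suc add_Suc_right by linarith
  then have D_anti: "k \<le> l \<Longrightarrow> D l \<le> D k" for k l
    by (rule lift_Suc_antimono_le)
  have D_n: "D n = D 0 - 15 * S n"
    using PQ_n(1) S_add_n[of "j0 + 4"] by (simp add: D_def add.assoc add.commute[of n 4])
  then have "S n = 0"
    using D_anti[of 0 n] \<open>S n \<le> 0\<close> by simp
  then show "(\<Sum>j<n. sum_list (x j)) = n"
    using S_n by linarith
  \<comment> \<open>With \<open>S n = 0\<close>, \<open>D\<close> agrees at \<open>0\<close> and
    \<open>n\<close> and so is constant in between. Every bound is attained, and the colour flips at
    each of the \<open>n\<close> steps.\<close>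
  have "Q (k + 4) = (Q 4 = even k)" if "k \<le> n" for k
    using that
  proof (induction k)
    case (Suc k)
    have "D (Suc k) = D k"
      using D_anti[of "Suc k" n] D_anti[of 0 k] D_anti[of k "Suc k"] D_n \<open>S n = 0\<close> Suc.prems
      by simp
    then have "P (Suc (k + 4)) = P (k + 4) + 15 * (int (sum_list (y (k + 4))) - 1)"
      using S_Suc[of "j0 + (k + 4)"]
      unfolding D_def c_y[symmetric] add_Suc add_Suc_right by linarith
    then show ?case
      using Q_flip[of "k + 4"] Suc by auto
  qed simp
  from this[of n] show "even n"
    using PQ_n(2) by auto
qed

section \<open>Distances in the product of a path and a cycle\<close>

abbreviation tube_adj :: "nat \<Rightarrow> nat \<times> nat \<Rightarrow> nat \<times> nat \<Rightarrow> bool" where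
  "tube_adj n \<equiv> cart_adj (path_adj 5) {0..<5} (cycle_adj n) {0..<n}"

lemma walk_trans: "walk adj k u v \<Longrightarrow> walk adj l v w \<Longrightarrow> walk adj (k + l) u w"
  by (induction k arbitrary: u) auto

lemma walk_sym:
  assumes "\<And>u v. adj u v \<Longrightarrow> adj v u"
  shows "walk adj k u v \<Longrightarrow> walk adj k v u"
proof (induction k arbitrary: u)
  case (Suc k)
  then obtain w where "adj u w" "walk adj k w v"
    by auto
  then have "walk adj k v w" "walk adj 1 w u"
    using Suc.IH assms by auto
  then show ?case
    using walk_trans by fastforce
qed simp

lemma tube_adj_sym: "tube_adj n u v \<Longrightarrow> tube_adj n v u"
  by (auto simp: cart_adj_def path_adj_def cycle_adj_def)

lemma walk_along_cycle:
  assumes "r < 5" and "i < n"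
  shows "walk (tube_adj n) d (r, i) (r, (i + d) mod n)"
proof (induction d)
  case (Suc d)
  have "walk (tube_adj n) 1 (r, (i + d) mod n) (r, (i + Suc d) mod n)"
    using assms by (auto simp: cart_adj_def cycle_adj_def mod_Suc_eq)
  from walk_trans[OF Suc this] show ?case
    by (simp only: Suc_eq_plus1)
qed (use assms in simp)

lemma walk_along_path:
  assumes "r + d < 5" and "i < n"
  shows "walk (tube_adj n) d (r, i) (r + d, i)"
  using assms(1)
proof (induction d)
  case (Suc d)
  have "walk (tube_adj n) 1 (r + d, i) (r + Suc d, i)"
    using Suc.prems assms(2) by (auto simp: cart_adj_def path_adj_def)
  then show ?case
    using walk_trans[OF Suc.IH] Suc.prems by fastforce
qed simp

lemma tube_walk:
  assumes "r < 5" "r' < 5" "i < n" "i' < n" and "i' = (i + d) mod n \<or> i = (i' + d) mod n"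
  shows "walk (tube_adj n) (d + (r - r') + (r' - r)) (r, i) (r', i')"
proof -
  have "walk (tube_adj n) d (r, i) (r, i')"
    using assms(5) walk_along_cycle[OF assms(1,3), of d]
      walk_sym[OF tube_adj_sym walk_along_cycle[OF assms(1,4), of d]] by auto
  moreover have "walk (tube_adj n) ((r - r') + (r' - r)) (r, i') (r', i')"
  proof (cases "r \<le> r'")
    case True
    then show ?thesis
      using walk_along_path[of r "r' - r" i' n] assms(2,4) by simp
  next
    case False
    then show ?thesis
      using walk_sym[OF tube_adj_sym walk_along_path[of r' "r - r'" i' n]] assms(1,4) by simp
  qed
  ultimately show ?thesis
    using walk_trans by (fastforce simp: add.assoc)
qed

lemma tube_gdist_le:
  assumes "r < 5" "r' < 5" "i < n" "i' < n" and "i' = (i + d) mod n \<or> i = (i' + d) mod n"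
  shows "gdist (tube_adj n) (r, i) (r', i') \<le> d + (r - r') + (r' - r)"
  unfolding gdist_def by (rule Least_le) (rule tube_walk[OF assms])

lemma tube_walk_gdist:
  assumes "r < 5" "r' < 5" "i < n" "i' < n"
  shows "walk (tube_adj n) (gdist (tube_adj n) (r, i) (r', i')) (r, i) (r', i')"
proof -
  \<comment> \<open>Going forward around the cycle gives some walk, so the \<open>LEAST\<close> in
    \<open>gdist\<close> is attained.\<close>
  have "i' = (i + (i' + n - i)) mod n"
    using assms(3,4) by simp
  from tube_walk[OF assms disjI1[OF this]] show ?thesis
    unfolding gdist_def by (rule LeastI)
qed

text \<open>The walk is lifted from the cycle to the integers, with \<open>d\<close> its net
  displacement. This treats short cycles uniformly, although there different displacements may end
  in the same column.\<close>

lemma walk_displacement: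
  "walk (tube_adj n) k (r, i) (r', i') \<Longrightarrow>
    \<exists>d. \<bar>d\<bar> + \<bar>int r - int r'\<bar> \<le> int k \<and> int n dvd int i + d - int i'"
proof (induction k arbitrary: r i)
  case 0
  then show ?case
    by (intro exI[of _ 0]) simp
next
  case (Suc k)
  then obtain r1 i1 where adj: "tube_adj n (r, i) (r1, i1)"
    and "walk (tube_adj n) k (r1, i1) (r', i')"
    by auto
  with Suc.IH obtain d where d: "\<bar>d\<bar> + \<bar>int r1 - int r'\<bar> \<le> int k"
    "int n dvd int i1 + d - int i'"
    by blast
  obtain e where e: "\<bar>e\<bar> + \<bar>int r - int r1\<bar> \<le> 1" "int n dvd int i + e - int i1"
  proof -
    from adj consider "r = r1" "i1 = (i + 1) mod n" | "r = r1" "i = (i1 + 1) mod n"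
      | "i = i1" "\<bar>int r - int r1\<bar> = 1"
      by (auto simp: cart_adj_def path_adj_def cycle_adj_def)
    then show thesis
    proof cases
      case 1
      then have "int n dvd int i + 1 - int i1"
        using dvd_minus_mod[of "int n" "int i + 1"] by (simp add: zmod_int add.commute)
      then show ?thesis
        using that[of 1] 1 by simp
    next
      case 2
      then have "int n dvd int i1 + 1 - int i"
        using dvd_minus_mod[of "int n" "int i1 + 1"] by (simp add: zmod_int add.commute)
      then have "int n dvd - (int i1 + 1 - int i)"
        by (simp only: dvd_minus_iff)
      then show ?thesis
        using that[of "- 1"] 2 by (simp add: algebra_simps)
    next
      case 3
      then show ?thesis
        using that[of 0] by simp
    qed
  qed
  have "int n dvd (int i + e - int i1) + (int i1 + d - int i')"
    using d(2) e(2) by (rule dvd_add[rotated])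
  then have "int n dvd int i + (e + d) - int i'"
    by (simp add: algebra_simps)
  moreover have "\<bar>e + d\<bar> + \<bar>int r - int r'\<bar> \<le> int (Suc k)"
    using d(1) e(1) by linarith
  ultimately show ?case
    by blast
qed

section \<open>The lower bound\<close>

lemma bcost_tube:
  fixes f :: "nat \<times> nat \<Rightarrow> nat"
  shows "bcost ({0..<5} \<times> {0..<n}) f = (\<Sum>j<n. \<Sum>r<5. f (r, j))"
proof -
  have "bcost ({0..<5} \<times> {0..<n}) f = (\<Sum>r<5. \<Sum>j<n. f (r, j))"
    unfolding bcost_def by (simp add: sum.cartesian_product atLeast0LessThan)
  also have "\<dots> = (\<Sum>j<n. \<Sum>r<5. f (r, j))"
    by (rule sum.swap)
  finally show ?thesis .
qed

lemma tube_broadcast_cost: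
  assumes "0 < n" and dom: "dom_broadcast2 ({0..<5} \<times> {0..<n}) (tube_adj n) f"
  shows "n + (if even n then 0 else 1) \<le> bcost ({0..<5} \<times> {0..<n}) f"
proof -
  define x where "x j = map (\<lambda>r. f (r, j mod n)) [0..<5]" for j
  have x_nth: "x j ! r = f (r, j mod n)" if "r < 5" for j r
    using that by (simp add: x_def del: upt_Suc)
  have f_le: "f (r, i) \<le> 2" if "r < 5" "i < n" for r i
    using dom that unfolding dom_broadcast2_def by auto
  have cost: "bcost ({0..<5} \<times> {0..<n}) f = (\<Sum>j<n. sum_list (x j))"
    unfolding bcost_tube
    by (intro sum.cong) (auto simp: x_def interv_sum_list_conv_sum_set_nat atLeast0LessThan
        simp del: upt_Suc)
  have covered: "covers 2 (x j) r \<or> covers 1 (x (j + 1)) r \<or> covers 0 (x (j + 2)) r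
      \<or> covers 1 (x (j + 3)) r \<or> covers 2 (x (j + 4)) r" if r: "r < 5" for j r
  proof -
    have i: "(j + 2) mod n < n"
      using \<open>0 < n\<close> by simp
    then have "(r, (j + 2) mod n) \<in> {0..<5} \<times> {0..<n}"
      using r by simp
    then obtain v where "v \<in> {0..<5} \<times> {0..<n}" "0 < f v"
      "gdist (tube_adj n) (r, (j + 2) mod n) v \<le> f v"
      using dom unfolding dom_broadcast2_def by blast
    then obtain r' i' where v: "r' < 5" "i' < n" "0 < f (r', i')"
      "gdist (tube_adj n) (r, (j + 2) mod n) (r', i') \<le> f (r', i')"
      by (cases v) auto
    obtain d where "\<bar>d\<bar> + \<bar>int r - int r'\<bar>
        \<le> int (gdist (tube_adj n) (r, (j + 2) mod n) (r', i'))"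
      and d2: "int n dvd int ((j + 2) mod n) + d - int i'"
      using walk_displacement[OF tube_walk_gdist[OF r v(1) i v(2)]] by blast
    then have d1: "\<bar>d\<bar> + \<bar>int r - int r'\<bar> \<le> int (f (r', i'))"
      using v(4) by linarith
    have "\<bar>d\<bar> \<le> 2"
      using d1 f_le[OF v(1,2)] by linarith
    \<comment> \<open>The listener sits in column \<open>j + 2\<close> and
      \<open>\<bar>d\<bar> \<le> 2\<close>, so \<open>j'\<close> is one of \<open>j\<close>, ...,
      \<open>j + 4\<close> and \<open>nat\<close> truncates nothing.\<close>
    define j' where "j' = nat (int j + 2 + d)"
    have j': "int j' = int j + 2 + d"
      using \<open>\<bar>d\<bar> \<le> 2\<close> by (simp add: j'_def)
    have "int n dvd int (j + 2) + d - int i'"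
    proof -
      have "int n dvd int (j + 2) - int ((j + 2) mod n)"
        unfolding zmod_int by (rule dvd_minus_mod)
      from dvd_add[OF this d2] show ?thesis
        by (simp add: algebra_simps)
    qed
    then have "int n dvd int j' - int i'"
      by (simp add: j' algebra_simps)
    then have "j' mod n = i'"
      using v(2) by (metis mod_eq_dvd_iff mod_less of_nat_eq_iff zmod_int)
    then have x_j': "x j' ! r' = f (r', i')"
      using x_nth[OF v(1)] by simp
    have cov: "covers k (x j') r" if "int k = \<bar>d\<bar>" for k
      unfolding covers_def
    proof (intro exI[of _ r'] conjI)
      show "k + (r - r') + (r' - r) \<le> x j' ! r'"
        using d1 that unfolding x_j' by linarith
    qed (use v x_j' in auto)
    have "d = - 2 \<or> d = - 1 \<or> d = 0 \<or> d = 1 \<or> d = 2"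
      using \<open>\<bar>d\<bar> \<le> 2\<close> by linarith
    then show ?thesis
    proof (elim disjE)
      assume "d = - 2"
      with j' have "j' = j" by simp
      then show ?thesis using cov[of 2] \<open>d = - 2\<close> by simp
    next
      assume "d = - 1"
      with j' have "j' = j + 1" by simp
      then show ?thesis using cov[of 1] \<open>d = - 1\<close> by simp
    next
      assume "d = 0"
      with j' have "j' = j + 2" by simp
      then show ?thesis using cov[of 0] \<open>d = 0\<close> by simp
    next
      assume "d = 1"
      with j' have "j' = j + 3" by simp
      then show ?thesis using cov[of 1] \<open>d = 1\<close> by simp
    next
      assume "d = 2"
      with j' have "j' = j + 4" by simp
      then show ?thesis using cov[of 2] \<open>d = 2\<close> by simp
    qed
  qed
  have "set (x j) \<subseteq> {0, 1, 2}" for j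
  proof
    fix v assume "v \<in> set (x j)"
    then obtain r where "r < 5" "v = f (r, j mod n)"
      by (auto simp: x_def simp del: upt_Suc)
    then show "v \<in> {0, 1, 2}"
      using f_le[of r "j mod n"] \<open>0 < n\<close> by fastforce
  qed
  moreover have "length (x j) = 5" for j
    by (simp add: x_def)
  moreover have "x (j + n) = x j" for j
    by (simp add: x_def)
  ultimately have "(\<Sum>j<n. sum_list (x j)) = n" "even n" if "(\<Sum>j<n. sum_list (x j)) \<le> n"
    using periodic_columns_cost[of n x] \<open>0 < n\<close> covered that by blast+
  \<comment> \<open>A cost of at most \<open>n\<close> forces equality and even \<open>n\<close>;
    hence odd \<open>n\<close> costs at least \<open>n + 1\<close>.\<close>
  then show ?thesis
    unfolding cost by (cases "(\<Sum>j<n. sum_list (x j)) \<le> n") auto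
qed

section \<open>Optimal broadcasts\<close>

text \<open>If \<open>n mod 4 = 2\<close>, the plain pattern puts a middle \<open>2\<close> in both
  columns \<open>n - 2\<close> and \<open>0\<close>, and the outer rows of column
  \<open>n - 1\<close> hear nothing. So the last five columns are emptied except for a
  \<open>2\<close> at both ends of their central column \<open>n - 3\<close>, at the same cost
  4.\<close>

definition tube_broadcast :: "nat \<Rightarrow> nat \<times> nat \<Rightarrow> nat" where
  "tube_broadcast n = (\<lambda>(r, j).
     if 5 \<le> r \<or> n \<le> j then 0
     else if n mod 4 = 2 \<and> n < j + 6 then (if j + 3 = n \<and> (r = 0 \<or> r = 4) then 2 else 0)
     else if j mod 4 = 0 \<and> r = 2 then 2
     else if j mod 4 = 2 \<and> (r = 0 \<or> r = 4) then 1 else 0)"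

text \<open>A middle \<open>2\<close> reaches its whole column, rows 1 to 3 of the adjacent columns
  and row 2 two columns away. The outer \<open>1\<close>s reach the rest of their own column and the
  outer rows beside it.\<close>

lemma tube_broadcast_hears:
  assumes "3 \<le> n" and "r < 5" and "j < n"
  obtains r' j' d where "r' < 5" and "j' < n" and "j' = (j + d) mod n \<or> j = (j' + d) mod n"
    and "0 < tube_broadcast n (r', j')" and "d + (r - r') + (r' - r) \<le> tube_broadcast n (r', j')"
proof -
  note hearI = that
  have r: "r = 0 \<or> r = 1 \<or> r = 2 \<or> r = 3 \<or> r = 4"
    using assms(2) by linarith
  \<comment> \<open>The third alternative is the only wrap around the cycle that occurs: forward
    into column \<open>0\<close>.\<close>
  have mod: "j' = (j + d) mod n \<or> j = (j' + d) mod n"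
    if "j' < n" "j' = j + d \<or> j = j' + d \<or> j' = 0 \<and> j + d = n" for j' d
    using that assms(3) by auto
  have mid: thesis
    if "j' < n" "j' = j + d \<or> j = j' + d \<or> j' = 0 \<and> j + d = n"
      "tube_broadcast n (2, j') = 2" "d + (r - 2) + (2 - r) \<le> 2" for j' d
    using hearI[OF _ that(1) mod[OF that(1,2)], of 2] that(3,4) by simp
  have ends: thesis
    if "j' < n" "j' = j + d \<or> j = j' + d \<or> j' = 0 \<and> j + d = n"
      "tube_broadcast n (0, j') = v" "tube_broadcast n (4, j') = v" "0 < v"
      "d + r \<le> v \<or> d + (4 - r) \<le> v" for j' d v
    using hearI[OF _ that(1) mod[OF that(1,2)], of 0] hearI[OF _ that(1) mod[OF that(1,2)], of 4]
      that(3-6) assms(2) by auto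
  show thesis
  proof (cases "n mod 4 = 2 \<and> n < j + 6")
    case True
    then have "n = 4 * ((n - 6) div 4) + 6"
      using assms(1) by presburger
    then obtain k where n: "n = 4 * k + 6" ..
    have f: "tube_broadcast n (2, 4 * k) = 2" "tube_broadcast n (2, 0) = 2"
      "tube_broadcast n (0, 4 * k + 3) = 2" "tube_broadcast n (4, 4 * k + 3) = 2"
      by (auto simp: tube_broadcast_def n)
    have "n < j + 6"
      using True by simp
    then consider "j = 4 * k + 1" | "j = 4 * k + 2" | "j = 4 * k + 3" | "j = 4 * k + 4"
      | "j = 4 * k + 5"
      using assms(3) n by linarith
    then show ?thesis
    proof cases
      case 1
      show ?thesis
      proof (cases "r = 0 \<or> r = 4")
        case True
        then show ?thesis
          by (intro ends[of "4 * k + 3" 2 2]) (use 1 n f in auto)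
      next
        case False
        then show ?thesis
          by (intro mid[of "4 * k" 1]) (use r 1 n f in auto)
      qed
    next
      case 2
      show ?thesis
      proof (cases "r = 2")
        case True
        then show ?thesis
          by (intro mid[of "4 * k" 2]) (use 2 n f in auto)
      next
        case False
        then show ?thesis
          by (intro ends[of "4 * k + 3" 1 2]) (use r 2 n f in auto)
      qed
    next
      case 3
      show ?thesis
        by (intro ends[of "4 * k + 3" 0 2]) (use r 3 n f in auto)
    next
      case 4
      show ?thesis
      proof (cases "r = 2")
        case True
        then show ?thesis
          by (intro mid[of 0 2]) (use 4 n f in auto)
      next
        case False
        then show ?thesis
          by (intro ends[of "4 * k + 3" 1 2]) (use r 4 n f in auto)
      qed
    next
      case 5
      show ?thesis
      proof (cases "r = 0 \<or> r = 4")
        case True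
        then show ?thesis
          by (intro ends[of "4 * k + 3" 2 2]) (use 5 n f in auto)
      next
        case False
        then show ?thesis
          by (intro mid[of 0 1]) (use r 5 n f in auto)
      qed
    qed
  next
    case False
    \<comment> \<open>If \<open>j + 6 = n\<close>, column \<open>j + 1\<close> opens the repaired
      block; but its index is odd when \<open>n mod 4 = 2\<close>, so residues 0 and 2 avoid the
      block.\<close>
    have f0: "tube_broadcast n (2, i) = 2" if "i mod 4 = 0" "i < n" "i \<le> j + 1" for i
      using that False by (auto simp: tube_broadcast_def) presburger+
    have f2: "tube_broadcast n (0, i) = 1" "tube_broadcast n (4, i) = 1"
      if "i mod 4 = 2" "i < n" "i \<le> j + 1" for i
      using that False by (auto simp: tube_broadcast_def) presburger+
    consider "j mod 4 = 0" | "j mod 4 = 1" | "j mod 4 = 2" | "j mod 4 = 3"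
      by linarith
    then show ?thesis
    proof cases
      case 1
      then have "tube_broadcast n (2, j) = 2"
        using f0 assms(3) by simp
      then show ?thesis
        by (intro mid[of j 0]) (use r assms(3) in auto)
    next
      case 2
      define i where "i = j - 1"
      have i: "j = i + 1" "i mod 4 = 0" "(j + 1) mod 4 = 2"
        using 2 unfolding i_def by presburger+
      show ?thesis
      proof (cases "r = 0 \<or> r = 4")
        case True
        \<comment> \<open>Otherwise \<open>n = j + 1\<close> is 2 modulo 4, which is the repaired
          case.\<close>
        have "j + 1 < n"
        proof (rule ccontr)
          assume "\<not> j + 1 < n"
          then have "n = j + 1"
            using assms(3) by simp
          then show False
            using i(3) False by simp
        qed
        then show ?thesis
          by (intro ends[of "j + 1" 1 1] f2) (use True i(3) in auto)
      next
        case False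
        then show ?thesis
          by (intro mid[of i 1] f0) (use r i assms(3) in auto)
      qed
    next
      case 3
      define i where "i = j - 2"
      have i: "j = i + 2" "i mod 4 = 0"
        using 3 unfolding i_def by presburger+
      show ?thesis
      proof (cases "r = 2")
        case True
        then show ?thesis
          by (intro mid[of i 2] f0) (use i assms(3) in auto)
      next
        case False
        then show ?thesis
          by (intro ends[of j 0 1] f2) (use r 3 assms(3) in auto)
      qed
    next
      case 4
      define i where "i = j - 1"
      have "j = i + 1"
        using 4 by (cases j) (auto simp: i_def)
      then have i: "j = i + 1" "i mod 4 = 2" "(j + 1) mod 4 = 0"
        using 4 by (auto simp: mod_Suc split: if_splits)
      show ?thesis
      proof (cases "r = 0 \<or> r = 4")
        case True
        then show ?thesis
          by (intro ends[of i 1 1] f2) (use i assms(3) in auto)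
      next
        case False
        then have d: "1 + (r - 2) + (2 - r) \<le> 2"
          using r by auto
        show ?thesis
        proof (cases "j + 1 = n")
          case True
          then show ?thesis
            by (intro mid[of 0 1] f0 d) auto
        next
          case False
          then show ?thesis
            by (intro mid[of "j + 1" 1] f0 d) (use i(3) assms(3) in auto)
        qed
      qed
    qed
  qed
qed

lemma tube_broadcast_dominating:
  assumes "3 \<le> n"
  shows "dom_broadcast2 ({0..<5} \<times> {0..<n}) (tube_adj n) (tube_broadcast n)"
  unfolding dom_broadcast2_def
proof (intro conjI ballI)
  fix u :: "nat \<times> nat" assume "u \<in> {0..<5} \<times> {0..<n}"
  then obtain r j where u: "u = (r, j)" "r < 5" "j < n"
    by auto
  from tube_broadcast_hears[OF assms this(2,3)] obtain r' j' d where
    v: "r' < 5" "j' < n" "j' = (j + d) mod n \<or> j = (j' + d) mod n"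
    "0 < tube_broadcast n (r', j')" "d + (r - r') + (r' - r) \<le> tube_broadcast n (r', j')"
    by blast
  have "gdist (tube_adj n) u (r', j') \<le> tube_broadcast n (r', j')"
    using tube_gdist_le[OF u(2) v(1) u(3) v(2,3)] v(5) unfolding u(1) by (rule le_trans)
  then show "\<exists>v\<in>{0..<5} \<times> {0..<n}. 0 < tube_broadcast n v
      \<and> gdist (tube_adj n) u v \<le> tube_broadcast n v"
    using v(1,2,4) by (intro bexI[of _ "(r', j')"]) auto
qed (auto simp: tube_broadcast_def)

lemma sum_even_positions: "(\<Sum>j<m. if even j then 2 else 0) = m + m mod (2::nat)"
  by (induction m) (auto simp: mod_2_eq_odd)

lemma tube_broadcast_cost_le:
  assumes "3 \<le> n"
  shows "bcost ({0..<5} \<times> {0..<n}) (tube_broadcast n) \<le> n + (if even n then 0 else 1)"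
proof -
  let ?f = "tube_broadcast n"
  let ?c = "\<lambda>j. \<Sum>r<5. ?f (r, j)"
  have col: "?c j = ?f (0, j) + ?f (1, j) + ?f (2, j) + ?f (3, j) + ?f (4, j)" for j
    by (simp add: eval_nat_numeral)
  have head: "?c j \<le> (if even j then 2 else 0)" if "\<not> (n mod 4 = 2 \<and> n < j + 6)" for j
  proof -
    have "j mod 4 = 0 \<and> even j \<or> j mod 4 = 2 \<and> even j
        \<or> j mod 4 \<noteq> 0 \<and> j mod 4 \<noteq> 2 \<and> odd j"
      by presburger
    then show ?thesis
      unfolding col using that by (elim disjE) (simp add: tube_broadcast_def, linarith)+
  qed
  show ?thesis
  proof (cases "n mod 4 = 2")
    case True
    then have "n = 4 * ((n - 6) div 4) + 6"
      using assms by presburger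
    then obtain k where n: "n = 4 * k + 6" ..
    \<comment> \<open>The first \<open>4 * k + 1\<close> columns cost at most
      \<open>4 * k + 2\<close> and the repaired block costs 4, in total \<open>n\<close>.\<close>
    have "(\<Sum>j<4 * k + 1. ?c j) \<le> (\<Sum>j<4 * k + 1. if even j then 2 else 0)"
      using n by (intro sum_mono head) auto
    also have "\<dots> = 4 * k + 2"
      unfolding sum_even_positions by presburger
    finally have "(\<Sum>j<4 * k + 1. ?c j) \<le> 4 * k + 2" .
    moreover have "?c (4 * k + 1) = 0" "?c (4 * k + 2) = 0" "?c (4 * k + 3) = 4"
      "?c (4 * k + 4) = 0" "?c (4 * k + 5) = 0"
      unfolding col by (simp_all add: tube_broadcast_def n)
    moreover have "(\<Sum>j<n. ?c j) = (\<Sum>j<4 * k + 1. ?c j) + ?c (4 * k + 1) + ?c (4 * k + 2)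
        + ?c (4 * k + 3) + ?c (4 * k + 4) + ?c (4 * k + 5)"
      by (simp add: n eval_nat_numeral)
    ultimately show ?thesis
      unfolding bcost_tube using n by simp
  next
    case False
    have "(\<Sum>j<n. ?c j) \<le> (\<Sum>j<n. if even j then 2 else 0)"
      using False by (intro sum_mono head) auto
    then show ?thesis
      unfolding bcost_tube sum_even_positions by (cases "even n") (simp_all add: mod_2_eq_odd)
  qed
qed

theorem theorem4p11:
  fixes n :: nat
  assumes "n \<ge> 3"
  shows "gamma_b2 ({0..<5} \<times> {0..<n})
           (cart_adj (path_adj 5) {0..<5} (cycle_adj n) {0..<n})
         = n + (if even n then 0 else 1)"
  unfolding gamma_b2_def
proof (rule Min_eqI)
  let ?V = "{0..<5::nat} \<times> {0..<n}"
  \<comment> \<open>Bounding the costs makes the set under \<open>Min\<close> finite.\<close>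
  have "bcost ?V f \<le> card ?V * 2" if "dom_broadcast2 ?V (tube_adj n) f" for f
  proof -
    have "f v \<le> 2" if "v \<in> ?V" for v
      using \<open>dom_broadcast2 ?V (tube_adj n) f\<close> that unfolding dom_broadcast2_def by blast
    then show ?thesis
      unfolding bcost_def using sum_bounded_above[of ?V f 2] by simp
  qed
  then show "finite {bcost ?V f |f. dom_broadcast2 ?V (tube_adj n) f}"
    by (intro finite_subset[OF _ finite_atMost[of "card ?V * 2"]]) auto
  show "n + (if even n then 0 else 1) \<le> c"
    if "c \<in> {bcost ?V f |f. dom_broadcast2 ?V (tube_adj n) f}" for c
    using that tube_broadcast_cost[of n] assms by auto
  have "n + (if even n then 0 else 1) = bcost ?V (tube_broadcast n)"
    using tube_broadcast_cost[OF _ tube_broadcast_dominating[OF assms]]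
      tube_broadcast_cost_le[OF assms] assms by (intro antisym) auto
  then show "n + (if even n then 0 else 1) \<in> {bcost ?V f |f. dom_broadcast2 ?V (tube_adj n) f}"
    using tube_broadcast_dominating[OF assms] by blast
qed

end
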